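(* Let $G$ be a finite group and $H\leq G$. Let $N=\bigcap_{x\in G}H^x$ be the core of $H$ in $G$. Then \[k(G)\leq k(H)+k(G/N)\max\Big\{|C_{\mathrm{cl}(N)}(g)|\ \Big|\ g\in G-\bigcup_{x\in G}H^x\Big\}.\]
   Context: For a finite group $X$, $k(X)$ denotes the number of conjugacy classes of $X$ and $\mathrm{cl}(X)$ the set of conjugacy classes of $X$. If $N\unlhd G$ and $g\in G$, then $C_{\mathrm{cl}(N)}(g)$ is the set of those $N$-conjugacy classes of $N$ which are mapped to themselves (as sets) by conjugation with $g$. $H^x=x^{-1}Hx$. The maximum over the empty set (which occurs only if $H=G$) is taken to be $0$. *)

theory Defs
  imports "HOL-Algebra.Algebra"
begin

text \<open>A subgroup H of G is turned into a group by \<open>G\<lparr>carrier := H\<rparr>\<close>, so that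
  \<open>conj_classes (G\<lparr>carrier := H\<rparr>)\<close> are the classes of H under conjugation by elements
  of H only. The conjugation action on elements is the one of
  \<open>group.action_by_conjugation\<close>; using \<open>x \<otimes> a \<otimes> inv x\<close> instead of
  \<open>inv x \<otimes> a \<otimes> x\<close> does not affect the orbits.\<close>

definition conj_classes :: "('a, 'b) monoid_scheme \<Rightarrow> 'a set set" where
  "conj_classes G = orbits G (carrier G)
     (\<lambda>x. \<lambda>a \<in> carrier G. x \<otimes>\<^bsub>G\<^esub> a \<otimes>\<^bsub>G\<^esub> inv\<^bsub>G\<^esub> x)"

definition class_number :: "('a, 'b) monoid_scheme \<Rightarrow> nat" where
  "class_number G = card (conj_classes G)"

definition conj_set :: "('a, 'b) monoid_scheme \<Rightarrow> 'a set \<Rightarrow> 'a \<Rightarrow> 'a set" where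
  "conj_set G A x = inv\<^bsub>G\<^esub> x <#\<^bsub>G\<^esub> A #>\<^bsub>G\<^esub> x"

definition core :: "('a, 'b) monoid_scheme \<Rightarrow> 'a set \<Rightarrow> 'a set" where
  "core G H = (\<Inter>x \<in> carrier G. conj_set G H x)"

definition fixed_classes :: "('a, 'b) monoid_scheme \<Rightarrow> 'a set \<Rightarrow> 'a \<Rightarrow> 'a set set" where
  "fixed_classes G N g = {K \<in> conj_classes (G\<lparr>carrier := N\<rparr>). conj_set G K g = K}"

definition Max0 :: "nat set \<Rightarrow> nat" where
  "Max0 S = (if S = {} then 0 else Max S)"

end

theory Submission
  imports Defs
begin

text \<open>A class of \<open>G\<close> that meets a conjugate of \<open>H\<close> meets \<open>H\<close>, so there are at most \<open>k(H)\<close> of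
  these. The other classes are sorted by the class of \<open>G/N\<close> into which they project. All classes
  over the class of \<open>Ng\<close> meet the coset \<open>Ng\<close>, so their number is at most the number of \<open>N\<close>-orbits
  on \<open>Ng\<close>; here \<open>g\<close> can be chosen inside one of the classes, hence outside all conjugates of \<open>H\<close>.
  The \<open>N\<close>-orbits on \<open>Ng\<close> are exactly as many as the \<open>g\<close>-invariant classes of \<open>N\<close>: by
  orbit counting, \<open>|N|\<close> times either number is the number of commuting pairs in \<open>N \<times> Ng\<close>,
  because the elements of \<open>Ng\<close> commuting with \<open>x \<in> N\<close> form a coset of \<open>C\<^sub>N(x)\<close> if the
  class of \<open>x\<close> is \<open>g\<close>-invariant, and do not exist otherwise.\<close>

section \<open>Orbits of a subgroup on the elements of the whole group under conjugation\<close>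

definition (in group) conj_orbit :: "'a set \<Rightarrow> 'a \<Rightarrow> 'a set" where
  "conj_orbit N a = (\<lambda>n. n \<otimes> a \<otimes> inv n) ` N"

lemma (in group) inv_mult_cancel:
  assumes "x \<in> carrier G" "y \<in> carrier G"
  shows "inv x \<otimes> (x \<otimes> y) = y" "x \<otimes> (inv x \<otimes> y) = y"
  using assms by (simp_all add: m_assoc[symmetric])

lemma (in group) conj_by_mult:
  assumes "x \<in> carrier G" "y \<in> carrier G" "a \<in> carrier G"
  shows "(x \<otimes> y) \<otimes> a \<otimes> inv (x \<otimes> y) = x \<otimes> (y \<otimes> a \<otimes> inv y) \<otimes> inv x"
  using assms by (simp add: inv_mult_group m_assoc)

lemma (in group) conj_eq_iff_commute:
  assumes "x \<in> carrier G" "a \<in> carrier G"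
  shows "x \<otimes> a \<otimes> inv x = a \<longleftrightarrow> x \<otimes> a = a \<otimes> x"
  using assms by (metis inv_closed inv_solve_right m_closed)

lemma (in group) conj_by_inv:
  assumes "x \<in> carrier G" "a \<in> carrier G" "b \<in> carrier G"
  shows "x \<otimes> a \<otimes> inv x = b \<longleftrightarrow> a = inv x \<otimes> b \<otimes> x"
proof
  show "a = inv x \<otimes> b \<otimes> x" if "x \<otimes> a \<otimes> inv x = b"
    unfolding that[symmetric] using assms by (simp add: m_assoc inv_mult_cancel)
  show "x \<otimes> a \<otimes> inv x = b" if "a = inv x \<otimes> b \<otimes> x"
    unfolding that using assms by (simp add: m_assoc inv_mult_cancel)
qed

lemma (in group) conj_orbit_closed:
  assumes "subgroup N G" "a \<in> carrier G" "b \<in> conj_orbit N a"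
  shows "b \<in> carrier G"
  using assms subgroup.mem_carrier[OF assms(1)] by (auto simp: conj_orbit_def)

lemma (in group) conj_orbit_subset:
  assumes "subgroup N G" "a \<in> N"
  shows "conj_orbit N a \<subseteq> N"
  using assms by (auto simp: conj_orbit_def subgroup.m_closed subgroup.m_inv_closed)

lemma (in group) conj_orbit_refl:
  assumes "subgroup N G" "a \<in> carrier G"
  shows "a \<in> conj_orbit N a"
  unfolding conj_orbit_def using assms subgroup.one_closed[OF assms(1)]
  by (intro image_eqI[of _ _ \<one>]) auto

lemma (in group) conj_orbit_eq:
  assumes N: "subgroup N G" and a: "a \<in> carrier G" and b: "b \<in> conj_orbit N a"
  shows "conj_orbit N b = conj_orbit N a"
proof -
  \<comment> \<open>Stated for arbitrary \<open>c\<close> and \<open>d\<close> because it is applied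
    in both directions, once \<open>a\<close> is known to lie in the orbit of
    \<open>b\<close>.\<close>
  have sub: "conj_orbit N d \<subseteq> conj_orbit N c"
    if c: "c \<in> carrier G" and d: "d \<in> conj_orbit N c" for c d
  proof
    fix e assume "e \<in> conj_orbit N d"
    then obtain m n where mn: "m \<in> N" "n \<in> N" "e = m \<otimes> (n \<otimes> c \<otimes> inv n) \<otimes> inv m"
      using d by (auto simp: conj_orbit_def)
    then have "e = (m \<otimes> n) \<otimes> c \<otimes> inv (m \<otimes> n)"
      using c subgroup.mem_carrier[OF N] by (simp add: conj_by_mult)
    then show "e \<in> conj_orbit N c"
      unfolding conj_orbit_def using mn subgroup.m_closed[OF N] by blast
  qed
  obtain n where n: "n \<in> N" "b = n \<otimes> a \<otimes> inv n"
    using b by (auto simp: conj_orbit_def)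
  have bG: "b \<in> carrier G" using conj_orbit_closed[OF N a b] .
  have nG: "n \<in> carrier G" using n subgroup.mem_carrier[OF N] by blast
  have "a = inv n \<otimes> b \<otimes> inv (inv n)"
    using n nG a bG conj_by_inv by (metis inv_inv)
  then have "a \<in> conj_orbit N b"
    unfolding conj_orbit_def using n subgroup.m_inv_closed[OF N] by blast
  then show ?thesis using sub a b bG by blast
qed

lemma (in group) orbit_conj:
  assumes "subgroup N G" "a \<in> carrier G"
  shows "orbit (G\<lparr>carrier := N\<rparr>) (\<lambda>x. \<lambda>a \<in> carrier G. x \<otimes> a \<otimes> inv x) a = conj_orbit N a"
  using assms by (auto simp: orbit_def conj_orbit_def)

lemma (in group) conj_classes_subgroup:
  assumes N: "subgroup N G"
  shows "conj_classes (G\<lparr>carrier := N\<rparr>) = conj_orbit N ` N"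
proof -
  \<comment> \<open>The classes of the subgroup are formed with its own inverse, which must first be
    identified with that of \<open>G\<close>.\<close>
  have "inv\<^bsub>G\<lparr>carrier := N\<rparr>\<^esub> x = inv x" if "x \<in> N" for x
    using that N by (simp add: m_inv_consistent)
  then show ?thesis
    by (simp add: conj_classes_def orbits_def orbit_def conj_orbit_def Setcompr_eq_image cong: image_cong)
qed

lemma (in group) conj_classes_eq: "conj_classes G = conj_orbit (carrier G) ` carrier G"
  using conj_classes_subgroup[OF subgroup_self] by simp

text \<open>By orbit-stabilizer, the stabilizer orders over one orbit add up to
  \<open>card N\<close>, and stabilizers are centralizers in \<open>N\<close>. \<open>S\<close> may
  be any family of orbits, since this is applied both to the orbits on a coset and to the invariant
  classes inside the normal subgroup.\<close>

lemma (in group) card_conj_orbits: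
  assumes fin: "finite (carrier G)" and N: "subgroup N G"
    and S: "S \<subseteq> conj_orbit N ` carrier G"
  shows "card S * card N = (\<Sum>a\<in>\<Union>S. card {n \<in> N. n \<otimes> a = a \<otimes> n})"
proof -
  let ?\<phi> = "\<lambda>x. \<lambda>a \<in> carrier G. x \<otimes> a \<otimes> inv x"
  let ?N = "G\<lparr>carrier := N\<rparr>"
  interpret A: group_action ?N "carrier G" ?\<phi>
    by (rule group_action.induced_action[OF action_by_conjugation N])
  have SO: "S \<subseteq> orbits ?N (carrier G) ?\<phi>"
  proof
    fix C assume "C \<in> S"
    then obtain a where "a \<in> carrier G" "C = conj_orbit N a" using S by blast
    then show "C \<in> orbits ?N (carrier G) ?\<phi>"
      unfolding orbits_def using orbit_conj[OF N] by blast
  qed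
  have finN: "finite N" using fin subgroup.subset[OF N] finite_subset by blast
  have carr: "\<Union>S \<subseteq> carrier G" using SO A.orbits_coverture by blast
  have "card S * card N = (\<Sum>C\<in>S. card N)" by simp
  also have "\<dots> = (\<Sum>C\<in>S. \<Sum>a\<in>C. card (stabilizer ?N ?\<phi> a))"
    using A.card_stablizer_sum SO finN by (intro sum.cong) (auto simp: order_def)
  also have "\<dots> = (\<Sum>a\<in>\<Union>S. card (stabilizer ?N ?\<phi> a))"
  proof (subst sum.Union_disjoint)
    show "\<forall>C\<in>S. finite C" using carr fin by (meson Union_upper finite_subset)
    show "\<forall>A\<in>S. \<forall>B\<in>S. A \<noteq> B \<longrightarrow> A \<inter> B = {}"
      using A.disjoint_union SO by blast
  qed simp
  also have "\<dots> = (\<Sum>a\<in>\<Union>S. card {n \<in> N. n \<otimes> a = a \<otimes> n})"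
  proof (intro sum.cong arg_cong[of _ _ card] refl)
    fix a assume "a \<in> \<Union>S"
    then have "a \<in> carrier G" using carr by blast
    then show "stabilizer ?N ?\<phi> a = {n \<in> N. n \<otimes> a = a \<otimes> n}"
      using subgroup.mem_carrier[OF N]
      by (simp add: stabilizer_def conj_eq_iff_commute cong: conj_cong)
  qed
  finally show ?thesis .
qed

section \<open>Conjugates of a subset, and normality of the core\<close>

lemma (in group) conj_set_iff:
  assumes "A \<subseteq> carrier G" "x \<in> carrier G"
  shows "b \<in> conj_set G A x \<longleftrightarrow> b \<in> carrier G \<and> x \<otimes> b \<otimes> inv x \<in> A"
proof
  assume "b \<in> conj_set G A x"
  then obtain a where a: "a \<in> A" "b = inv x \<otimes> a \<otimes> x"
    by (auto simp: conj_set_def r_coset_def l_coset_def)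
  with assms have aG: "a \<in> carrier G" by blast
  with a assms have bG: "b \<in> carrier G" by simp
  with a aG assms have "x \<otimes> b \<otimes> inv x = a" by (simp add: conj_by_inv)
  with a bG show "b \<in> carrier G \<and> x \<otimes> b \<otimes> inv x \<in> A" by simp
next
  assume b: "b \<in> carrier G \<and> x \<otimes> b \<otimes> inv x \<in> A"
  then have "b = inv x \<otimes> (x \<otimes> b \<otimes> inv x) \<otimes> x"
    using assms conj_by_inv[of x b "x \<otimes> b \<otimes> inv x"] by auto
  with b show "b \<in> conj_set G A x"
    by (auto simp: conj_set_def r_coset_def l_coset_def)
qed

lemma (in group) core_iff:
  assumes "H \<subseteq> carrier G"
  shows "b \<in> core G H \<longleftrightarrow> b \<in> carrier G \<and> (\<forall>x\<in>carrier G. x \<otimes> b \<otimes> inv x \<in> H)"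
  using assms by (auto simp: core_def conj_set_iff)

lemma (in group) core_normal:
  assumes H: "subgroup H G"
  shows "core G H \<lhd> G"
proof -
  have HG: "H \<subseteq> carrier G" using subgroup.subset[OF H] .
  have "subgroup (core G H) G"
  proof
    show "core G H \<subseteq> carrier G" using core_iff[OF HG] by blast
    show "\<one> \<in> core G H" using core_iff[OF HG] subgroup.one_closed[OF H] by simp
    show "a \<otimes> b \<in> core G H" if ab: "a \<in> core G H" "b \<in> core G H" for a b
    proof -
      have abG: "a \<in> carrier G" "b \<in> carrier G" using ab core_iff[OF HG] by auto
      have "x \<otimes> (a \<otimes> b) \<otimes> inv x \<in> H" if x: "x \<in> carrier G" for x
      proof -
        have "x \<otimes> (a \<otimes> b) \<otimes> inv x = (x \<otimes> a \<otimes> inv x) \<otimes> (x \<otimes> b \<otimes> inv x)"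
          using abG x by (simp add: m_assoc inv_mult_cancel)
        then show ?thesis using ab x core_iff[OF HG] subgroup.m_closed[OF H] by simp
      qed
      then show ?thesis using abG core_iff[OF HG] by simp
    qed
    show "inv a \<in> core G H" if a: "a \<in> core G H" for a
    proof -
      have aG: "a \<in> carrier G" using a core_iff[OF HG] by auto
      have "x \<otimes> inv a \<otimes> inv x \<in> H" if x: "x \<in> carrier G" for x
      proof -
        have "x \<otimes> inv a \<otimes> inv x = inv (x \<otimes> a \<otimes> inv x)"
          using aG x by (simp add: m_assoc inv_mult_group)
        then show ?thesis using a x core_iff[OF HG] subgroup.m_inv_closed[OF H] by simp
      qed
      then show ?thesis using aG core_iff[OF HG] by simp
    qed
  qed
  moreover have "x \<otimes> h \<otimes> inv x \<in> core G H" if x: "x \<in> carrier G" and h: "h \<in> core G H" for x h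
  proof -
    have hG: "h \<in> carrier G" using h core_iff[OF HG] by auto
    \<comment> \<open>Conjugating by \<open>x\<close> and then by \<open>y\<close> is conjugating by
      \<open>y \<otimes> x\<close>, where the membership condition for \<open>h\<close>
      applies.\<close>
    have "y \<otimes> (x \<otimes> h \<otimes> inv x) \<otimes> inv y \<in> H" if "y \<in> carrier G" for y
      using that x hG h core_iff[OF HG] conj_by_mult[of y x h] by (metis m_closed)
    then show ?thesis using x hG core_iff[OF HG] by simp
  qed
  ultimately show ?thesis by (simp add: normal_inv_iff)
qed

section \<open>Orbits of a normal subgroup (the \<open>H\<close> of the locale
  \<open>normal\<close>, later the core) on its cosets\<close>

lemma (in normal) conj_orbit_conj:
  assumes "x \<in> carrier G" "a \<in> carrier G"
  shows "conj_set G (conj_orbit H a) x = conj_orbit H (inv x \<otimes> a \<otimes> x)"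
proof -
  have "b \<in> conj_set G (conj_orbit H a) x \<longleftrightarrow> b \<in> conj_orbit H (inv x \<otimes> a \<otimes> x)" for b
  proof
    assume "b \<in> conj_set G (conj_orbit H a) x"
    then obtain n where n: "n \<in> H" "b = inv x \<otimes> (n \<otimes> a \<otimes> inv n) \<otimes> x"
      by (auto simp: conj_set_def r_coset_def l_coset_def conj_orbit_def)
    \<comment> \<open>Conjugation by \<open>x\<close> turns the action of \<open>n\<close> into that
      of \<open>?m\<close>, and normality keeps \<open>?m\<close> in \<open>H\<close>;
      \<open>?n\<close> below is the reverse passage.\<close>
    let ?m = "inv x \<otimes> n \<otimes> x"
    have "?m \<in> H" using assms n by (simp add: inv_op_closed1)
    moreover have "b = ?m \<otimes> (inv x \<otimes> a \<otimes> x) \<otimes> inv ?m"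
      using assms n mem_carrier by (simp add: m_assoc inv_mult_group inv_mult_cancel)
    ultimately show "b \<in> conj_orbit H (inv x \<otimes> a \<otimes> x)"
      unfolding conj_orbit_def by blast
  next
    assume "b \<in> conj_orbit H (inv x \<otimes> a \<otimes> x)"
    then obtain m where m: "m \<in> H" "b = m \<otimes> (inv x \<otimes> a \<otimes> x) \<otimes> inv m"
      by (auto simp: conj_orbit_def)
    let ?n = "x \<otimes> m \<otimes> inv x"
    have "?n \<in> H" using assms m by (simp add: inv_op_closed2)
    moreover have "b = inv x \<otimes> (?n \<otimes> a \<otimes> inv ?n) \<otimes> x"
      using assms m mem_carrier by (simp add: m_assoc inv_mult_group inv_mult_cancel)
    ultimately show "b \<in> conj_set G (conj_orbit H a) x"
      by (auto simp: conj_set_def r_coset_def l_coset_def conj_orbit_def)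
  qed
  then show ?thesis by blast
qed

text \<open>Moving \<open>inv n\<close> to the left past \<open>g\<close> replaces it by
  \<open>g \<otimes> inv n \<otimes> inv g\<close>, which is still in \<open>H\<close>.\<close>

lemma (in normal) conj_orbit_subset_coset:
  assumes "g \<in> carrier G" "y \<in> H #> g"
  shows "conj_orbit H y \<subseteq> H #> g"
proof
  fix z assume "z \<in> conj_orbit H y"
  then obtain m n where mn: "m \<in> H" "n \<in> H" "z = n \<otimes> (m \<otimes> g) \<otimes> inv n"
    using assms by (auto simp: conj_orbit_def r_coset_def)
  have "g \<otimes> inv n \<otimes> inv g \<in> H" using assms mn by (simp add: inv_op_closed2)
  then have "n \<otimes> m \<otimes> (g \<otimes> inv n \<otimes> inv g) \<in> H" using mn by simp
  moreover have "z = n \<otimes> m \<otimes> (g \<otimes> inv n \<otimes> inv g) \<otimes> g"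
    using mn assms by (simp add: m_assoc inv_mult_cancel)
  ultimately show "z \<in> H #> g" by (auto simp: r_coset_def)
qed

text \<open>An element of \<open>H #> g\<close> commuting with \<open>x\<close> exhibits
  \<open>inv g \<otimes> x \<otimes> g\<close> as an \<open>H\<close>-conjugate of \<open>x\<close>.
  Conversely, such a conjugacy yields one commuting element, and the others arise from it by left
  multiplication with the centralizer of \<open>x\<close> in \<open>H\<close>.\<close>

lemma (in normal) card_commuting_coset:
  assumes g: "g \<in> carrier G" and x: "x \<in> H"
  shows "card {y \<in> H #> g. x \<otimes> y = y \<otimes> x} =
    (if conj_orbit H (inv g \<otimes> x \<otimes> g) = conj_orbit H x then card {n \<in> H. n \<otimes> x = x \<otimes> n} else 0)"
proof (cases "conj_orbit H (inv g \<otimes> x \<otimes> g) = conj_orbit H x")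
  case True
  have xG: "x \<in> carrier G" using x by simp
  have "inv g \<otimes> x \<otimes> g \<in> conj_orbit H x"
    using conj_orbit_refl[OF subgroup_axioms, of "inv g \<otimes> x \<otimes> g"] g xG True by simp
  then obtain m where m: "m \<in> H" "m \<otimes> x \<otimes> inv m = inv g \<otimes> x \<otimes> g"
    by (auto simp: conj_orbit_def)
  have mG: "m \<in> carrier G" using m by simp
  \<comment> \<open>\<open>m\<close> takes \<open>x\<close> to
    \<open>inv g \<otimes> x \<otimes> g\<close> and \<open>g\<close> takes this back to
    \<open>x\<close>, so the product centralizes \<open>x\<close>; it lies in the left coset of
    \<open>g\<close>, which is also the right one.\<close>
  define y0 where "y0 = g \<otimes> m"
  have y0G: "y0 \<in> carrier G" using g mG by (simp add: y0_def)
  have "g \<otimes> m \<in> g <# H" using m by (auto simp: l_coset_def)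
  then have "y0 \<in> H #> g" using coset_eq g by (simp add: y0_def)
  then obtain n0 where n0: "n0 \<in> H" "y0 = n0 \<otimes> g" by (auto simp: r_coset_def)
  have "y0 \<otimes> x = g \<otimes> (m \<otimes> x \<otimes> inv m) \<otimes> m"
    using g mG xG by (simp add: y0_def m_assoc inv_mult_cancel)
  also have "\<dots> = x \<otimes> y0"
    using g mG xG unfolding m(2) by (simp add: y0_def m_assoc inv_mult_cancel)
  finally have y0x: "y0 \<otimes> x = x \<otimes> y0" .
  have "(\<lambda>n. n \<otimes> y0) ` {n \<in> H. n \<otimes> x = x \<otimes> n} = {y \<in> H #> g. x \<otimes> y = y \<otimes> x}"
  proof (intro equalityI subsetI)
    fix y assume "y \<in> (\<lambda>n. n \<otimes> y0) ` {n \<in> H. n \<otimes> x = x \<otimes> n}"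
    then obtain n where n: "n \<in> H" "n \<otimes> x = x \<otimes> n" "y = n \<otimes> y0" by blast
    have nG: "n \<in> carrier G" using n by simp
    have "y = n \<otimes> n0 \<otimes> g" using n n0 g by (simp add: m_assoc)
    then have "y \<in> H #> g" using n n0 by (auto simp: r_coset_def)
    moreover have "x \<otimes> y = n \<otimes> x \<otimes> y0"
      unfolding n(2,3) using nG xG y0G by (simp add: m_assoc)
    then have "x \<otimes> y = y \<otimes> x"
      unfolding n(3) using nG xG y0G y0x by (simp add: m_assoc)
    ultimately show "y \<in> {y \<in> H #> g. x \<otimes> y = y \<otimes> x}" by simp
  next
    fix y assume "y \<in> {y \<in> H #> g. x \<otimes> y = y \<otimes> x}"
    then obtain n where n: "n \<in> H" "y = n \<otimes> g" and yx: "x \<otimes> y = y \<otimes> x"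
      by (auto simp: r_coset_def)
    have yG: "y \<in> carrier G" using n g by simp
    \<comment> \<open>As \<open>y = n \<otimes> g\<close> and \<open>y0 = n0 \<otimes> g\<close>,
      this is the quotient of \<open>y\<close> by \<open>y0\<close>, both of which commute with
      \<open>x\<close>.\<close>
    define k where "k = n \<otimes> inv n0"
    have kH: "k \<in> H" using n n0 by (simp add: k_def)
    have kG: "k \<in> carrier G" using kH by simp
    have y: "y = k \<otimes> y0"
      using n n0 g by (simp add: k_def m_assoc inv_mult_cancel)
    have "(k \<otimes> x) \<otimes> y0 = k \<otimes> (y0 \<otimes> x)"
      using kG xG y0G y0x by (simp add: m_assoc)
    also have "\<dots> = x \<otimes> y" using kG xG y0G yx y by (simp add: m_assoc)
    also have "\<dots> = (x \<otimes> k) \<otimes> y0" using kG xG y0G y by (simp add: m_assoc)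
    finally have "k \<otimes> x = x \<otimes> k" using kG xG y0G by simp
    then show "y \<in> (\<lambda>n. n \<otimes> y0) ` {n \<in> H. n \<otimes> x = x \<otimes> n}" using kH y by blast
  qed
  moreover have "inj_on (\<lambda>n. n \<otimes> y0) {n \<in> H. n \<otimes> x = x \<otimes> n}"
    using y0G by (auto intro!: inj_onI)
  ultimately show ?thesis using True card_image by fastforce
next
  case False
  have xG: "x \<in> carrier G" using x by simp
  have "x \<otimes> y \<noteq> y \<otimes> x" if y: "y \<in> H #> g" for y
  proof
    assume yx: "x \<otimes> y = y \<otimes> x"
    obtain n where n: "n \<in> H" "y = n \<otimes> g" using y by (auto simp: r_coset_def)
    have yG: "y \<in> carrier G" using n g by simp
    \<comment> \<open>Chosen so that \<open>y = g \<otimes> ?m\<close>; cancelling \<open>g\<close>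
      in the conjugation by \<open>y\<close> leaves the conjugation by \<open>?m\<close>.\<close>
    let ?m = "inv g \<otimes> n \<otimes> g"
    have "?m \<in> H" using g n by (simp add: inv_op_closed1)
    have "y \<otimes> x \<otimes> inv y = x"
      using yG xG yx by (simp add: conj_eq_iff_commute)
    then have "inv g \<otimes> x \<otimes> g = inv g \<otimes> (y \<otimes> x \<otimes> inv y) \<otimes> g" by simp
    also have "\<dots> = ?m \<otimes> x \<otimes> inv ?m"
      using n g xG by (simp add: m_assoc inv_mult_group inv_mult_cancel)
    finally have "inv g \<otimes> x \<otimes> g \<in> conj_orbit H x"
      unfolding conj_orbit_def using \<open>?m \<in> H\<close> by blast
    then show False using conj_orbit_eq[OF subgroup_axioms xG] False by blast
  qed
  then have none: "{y \<in> H #> g. x \<otimes> y = y \<otimes> x} = {}" by blast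
  show ?thesis unfolding none using False by simp
qed

lemma (in normal) card_conj_orbits_coset:
  assumes fin: "finite (carrier G)" and g: "g \<in> carrier G"
  shows "card (conj_orbit H ` (H #> g)) = card (fixed_classes G H g)"
proof -
  note sub = subgroup_axioms
  \<comment> \<open>The union of the \<open>g\<close>-invariant classes, with invariance expressed
    through an element as in \<open>card_commuting_coset\<close>.\<close>
  define F where "F = {x \<in> H. conj_orbit H (inv g \<otimes> x \<otimes> g) = conj_orbit H x}"
  have finH: "finite H" using fin finite_subset subset by blast
  have cosetG: "H #> g \<subseteq> carrier G" using g r_coset_subset_G subset by blast
  have finC: "finite (H #> g)" using cosetG fin finite_subset by blast
  have US1: "\<Union>(conj_orbit H ` (H #> g)) = H #> g"
    using conj_orbit_subset_coset[OF g] conj_orbit_refl[OF sub] cosetG by blast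
  have fixed: "fixed_classes G H g = conj_orbit H ` F"
  proof -
    have "fixed_classes G H g = conj_orbit H ` {x \<in> H. conj_set G (conj_orbit H x) g = conj_orbit H x}"
      unfolding fixed_classes_def conj_classes_subgroup[OF sub] by blast
    then show ?thesis unfolding F_def using g by (simp add: conj_orbit_conj cong: conj_cong)
  qed
  \<comment> \<open>Invariance depends only on the class of an element, so \<open>F\<close> is a
    union of classes; orbit counting for these classes then sums over exactly
    \<open>F\<close>.\<close>
  have US2: "\<Union>(conj_orbit H ` F) = F"
  proof (intro equalityI subsetI)
    fix b assume "b \<in> \<Union>(conj_orbit H ` F)"
    then obtain a where a: "a \<in> F" "b \<in> conj_orbit H a" by blast
    have aH: "a \<in> H" using a by (simp add: F_def)
    have bH: "b \<in> H" using conj_orbit_subset[OF sub aH] a by blast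
    have "conj_orbit H b = conj_orbit H a" using conj_orbit_eq[OF sub] a aH by simp
    moreover from this have "conj_orbit H (inv g \<otimes> b \<otimes> g) = conj_orbit H (inv g \<otimes> a \<otimes> g)"
      using conj_orbit_conj[OF g] aH bH by (metis mem_carrier)
    ultimately show "b \<in> F" using a bH by (simp add: F_def)
  next
    fix b assume b: "b \<in> F"
    then have "b \<in> carrier G" by (simp add: F_def)
    then show "b \<in> \<Union>(conj_orbit H ` F)" using b conj_orbit_refl[OF sub] by blast
  qed
  have "card (conj_orbit H ` (H #> g)) * card H = (\<Sum>y\<in>H #> g. card {x \<in> H. x \<otimes> y = y \<otimes> x})"
    using card_conj_orbits[OF fin sub image_mono[OF cosetG]] unfolding US1 .
  \<comment> \<open>The commuting pairs are now counted by their component in \<open>H\<close>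
    instead of the one in the coset.\<close>
  also have "\<dots> = (\<Sum>x\<in>H. card {y \<in> H #> g. x \<otimes> y = y \<otimes> x})"
    using sum.swap_restrict[OF finC finH, of "\<lambda>_ _. 1::nat" "\<lambda>y x. x \<otimes> y = y \<otimes> x"] by simp
  \<comment> \<open>Elements outside \<open>F\<close> commute with nothing in the coset and
    contribute 0.\<close>
  also have "\<dots> = (\<Sum>x\<in>F. card {n \<in> H. n \<otimes> x = x \<otimes> n})"
    unfolding F_def using finH g by (simp add: card_commuting_coset sum.inter_filter)
  also have "\<dots> = card (fixed_classes G H g) * card H"
  proof -
    have "F \<subseteq> carrier G" by (auto simp: F_def)
    then show ?thesis
      using card_conj_orbits[OF fin sub image_mono, of F] unfolding US2 fixed by simp
  qed
  finally have "card (conj_orbit H ` (H #> g)) * card H = card (fixed_classes G H g) * card H" .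
  moreover have "card H \<noteq> 0" using finH subgroup.one_closed[OF sub] by (metis card_0_eq empty_iff)
  ultimately show ?thesis by simp
qed

section \<open>Passing from orbits of a subgroup to classes of \<open>G\<close>\<close>

lemma (in group) conj_orbit_saturate:
  assumes "subgroup N G" "a \<in> carrier G"
  shows "(\<Union>b\<in>conj_orbit N a. conj_orbit (carrier G) b) = conj_orbit (carrier G) a"
proof -
  have "conj_orbit (carrier G) b = conj_orbit (carrier G) a" if "b \<in> conj_orbit N a" for b
  proof -
    have "b \<in> conj_orbit (carrier G) a"
      using that subgroup.mem_carrier[OF assms(1)] by (auto simp: conj_orbit_def)
    then show ?thesis using conj_orbit_eq[OF subgroup_self assms(2)] by blast
  qed
  then have "(\<Union>b\<in>conj_orbit N a. conj_orbit (carrier G) b)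
    = (\<Union>b\<in>conj_orbit N a. conj_orbit (carrier G) a)" by (rule SUP_cong[OF refl])
  \<comment> \<open>The constant union collapses to its value because \<open>a\<close> makes the
    index set nonempty.\<close>
  then show ?thesis using conj_orbit_refl[OF assms] by (metis UN_constant empty_iff)
qed

lemma (in group) conj_class_eq:
  assumes "C \<in> conj_classes G" "a \<in> C"
  shows "a \<in> carrier G" "C = conj_orbit (carrier G) a"
proof -
  obtain c where "c \<in> carrier G" "C = conj_orbit (carrier G) c"
    using assms by (auto simp: conj_classes_eq)
  then show "a \<in> carrier G" "C = conj_orbit (carrier G) a"
    using assms conj_orbit_closed[OF subgroup_self] conj_orbit_eq[OF subgroup_self] by blast+
qed

text \<open>The union over \<open>K\<close> defines a map from \<open>N\<close>-orbits to classes of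
  \<open>G\<close> without choosing representatives. It hits every class meeting \<open>A\<close>,
  so there are at most as many such classes as \<open>N\<close>-orbits of elements of
  \<open>A\<close>.\<close>

lemma (in group) conj_class_in_saturated_orbits:
  assumes "subgroup N G" "C \<in> conj_classes G" "a \<in> C" "a \<in> A"
  shows "C \<in> (\<lambda>K. \<Union>b\<in>K. conj_orbit (carrier G) b) ` conj_orbit N ` A"
proof -
  have "C = (\<Union>b\<in>conj_orbit N a. conj_orbit (carrier G) b)"
    using conj_class_eq[OF assms(2,3)] conj_orbit_saturate[OF assms(1)] by simp
  then show ?thesis by (rule image_eqI[OF _ imageI[OF assms(4)]])
qed

lemma (in group) conj_class_conj:
  assumes "C \<in> conj_classes G" "a \<in> C" "x \<in> carrier G"
  shows "x \<otimes> a \<otimes> inv x \<in> C"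
  using conj_class_eq[OF assms(1,2)] assms(3) by (auto simp: conj_orbit_def)

lemma (in group) card_classes_meeting_subgroup:
  assumes fin: "finite (carrier G)" and H: "subgroup H G"
  shows "card {C \<in> conj_classes G. C \<inter> H \<noteq> {}} \<le> class_number (G\<lparr>carrier := H\<rparr>)"
proof -
  have finH: "finite H" using fin subgroup.subset[OF H] finite_subset by blast
  have "{C \<in> conj_classes G. C \<inter> H \<noteq> {}} \<subseteq>
    (\<lambda>K. \<Union>b\<in>K. conj_orbit (carrier G) b) ` conj_orbit H ` H"
  proof
    fix C assume "C \<in> {C \<in> conj_classes G. C \<inter> H \<noteq> {}}"
    then obtain a where "C \<in> conj_classes G" "a \<in> C" "a \<in> H" by blast
    then show "C \<in> (\<lambda>K. \<Union>b\<in>K. conj_orbit (carrier G) b) ` conj_orbit H ` H"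
      by (rule conj_class_in_saturated_orbits[OF H])
  qed
  then show ?thesis
    unfolding class_number_def conj_classes_subgroup[OF H]
    using finH by (intro surj_card_le) auto
qed

lemma (in normal) card_classes_over:
  assumes fin: "finite (carrier G)" and D: "D \<in> conj_classes (G Mod H)"
    and g: "g \<in> carrier G" "H #> g \<in> D"
  shows "card {C \<in> conj_classes G. \<exists>c\<in>C. H #> c \<in> D} \<le> card (fixed_classes G H g)"
proof -
  interpret Q: group "G Mod H" by (rule factorgroup_is_group)
  have cosetG: "H #> g \<subseteq> carrier G" using g r_coset_subset_G subset by blast
  have finC: "finite (H #> g)" using cosetG fin finite_subset by blast
  have "{C \<in> conj_classes G. \<exists>c\<in>C. H #> c \<in> D} \<subseteq>
    (\<lambda>K. \<Union>b\<in>K. conj_orbit (carrier G) b) ` conj_orbit H ` (H #> g)"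
  proof
    fix C assume "C \<in> {C \<in> conj_classes G. \<exists>c\<in>C. H #> c \<in> D}"
    then obtain c where C: "C \<in> conj_classes G" "c \<in> C" "H #> c \<in> D" by blast
    have cG: "c \<in> carrier G" using conj_class_eq C by blast
    \<comment> \<open>\<open>D\<close> is the quotient class of \<open>H #> g\<close>, so the coset
      of \<open>c\<close> is conjugate to \<open>H #> g\<close>, say by the coset of
      \<open>x\<close>.\<close>
    have "H #> c \<in> Q.conj_orbit (carrier (G Mod H)) (H #> g)"
      using Q.conj_class_eq[OF D g(2)] C(3) by blast
    then obtain x where x: "x \<in> carrier G"
      and "H #> c = (H #> x) <#> (H #> g) <#> inv\<^bsub>G Mod H\<^esub> (H #> x)"
      by (auto simp: Q.conj_orbit_def carrier_FactGroup)
    moreover have "H #> x \<in> carrier (G Mod H)" using x by (simp add: carrier_FactGroup)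
    ultimately have "H #> c = H #> (x \<otimes> g \<otimes> inv x)"
      using g by (simp add: inv_FactGroup rcos_inv rcos_sum)
    then have "c \<in> H #> (x \<otimes> g \<otimes> inv x)"
      using rcos_self[OF cG] subgroup_axioms by blast
    then obtain n where n: "n \<in> H" "c = n \<otimes> (x \<otimes> g \<otimes> inv x)" by (auto simp: r_coset_def)
    \<comment> \<open>Undoing the conjugation by \<open>x\<close> moves \<open>c\<close> into
      \<open>H #> g\<close> within its class \<open>C\<close>. The double inverse matches the form
      of \<open>conj_class_conj\<close>.\<close>
    let ?a = "inv x \<otimes> c \<otimes> inv (inv x)"
    have "?a = (inv x \<otimes> n \<otimes> x) \<otimes> g"
      using n x g by (simp add: m_assoc inv_mult_cancel)
    moreover have "inv x \<otimes> n \<otimes> x \<in> H" using n x by (simp add: inv_op_closed1)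
    ultimately have a: "?a \<in> H #> g" by (auto simp: r_coset_def)
    have "?a \<in> C" using conj_class_conj[OF C(1,2) inv_closed[OF x]] .
    then show "C \<in> (\<lambda>K. \<Union>b\<in>K. conj_orbit (carrier G) b) ` conj_orbit H ` (H #> g)"
      using conj_class_in_saturated_orbits[OF subgroup_axioms C(1)] a by simp
  qed
  then have "card {C \<in> conj_classes G. \<exists>c\<in>C. H #> c \<in> D} \<le> card (conj_orbit H ` (H #> g))"
    using finC by (intro surj_card_le) auto
  then show ?thesis using card_conj_orbits_coset[OF fin g(1)] by simp
qed

section \<open>Assembling the estimate from the classes meeting \<open>H\<close> and those avoiding
  it\<close>

theorem lemmaB:
  fixes G :: "('a, 'b) monoid_scheme" and H N :: "'a set"
  assumes "group G"
    and "finite (carrier G)"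
    and "subgroup H G"
    and "N = core G H"
  shows "class_number G \<le> class_number (G\<lparr>carrier := H\<rparr>)
    + class_number (G Mod N)
      * Max0 {card (fixed_classes G N g) | g. g \<in> carrier G - (\<Union>x \<in> carrier G. conj_set G H x)}"
proof -
  interpret group G by fact
  interpret N: normal N G using core_normal assms by blast
  interpret Q: group "G Mod N" by (rule N.factorgroup_is_group)
  define U where "U = (\<Union>x \<in> carrier G. conj_set G H x)"
  define M where "M = Max0 {card (fixed_classes G N g) | g. g \<in> carrier G - U}"
  define B where "B = {C \<in> conj_classes G. C \<inter> H = {}}"
  have finG: "finite (carrier G)" by fact
  have HG: "H \<subseteq> carrier G" using assms(3) subgroup.subset by blast
  have finQ: "finite (conj_classes (G Mod N))"
    using finG by (simp add: Q.conj_classes_eq carrier_FactGroup)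
  have finB: "finite B" using finG by (simp add: B_def conj_classes_eq)
  have M: "card (fixed_classes G N g) \<le> M" if "g \<in> carrier G - U" for g
  proof -
    let ?S = "{card (fixed_classes G N g) | g. g \<in> carrier G - U}"
    have "finite ?S" using finG by (simp add: Setcompr_eq_image)
    moreover have "card (fixed_classes G N g) \<in> ?S" using that by blast
    \<comment> \<open>The given \<open>g\<close> makes \<open>?S\<close> nonempty, so
      \<open>Max0\<close> is a true maximum here and not its default 0.\<close>
    ultimately show ?thesis by (auto simp: M_def Max0_def intro: Max_ge)
  qed
  \<comment> \<open>A class containing an element of a conjugate of \<open>H\<close> also contains
    an element of \<open>H\<close>, so members of \<open>B\<close> avoid all of
    \<open>U\<close>.\<close>
  have notU: "g \<notin> U" if "C \<in> B" "g \<in> C" for C g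
    using that conj_class_conj HG by (fastforce simp: B_def U_def conj_set_iff)
  \<comment> \<open>Each class in \<open>B\<close> is placed over the quotient class of the coset of
    one of its elements, preparing a union bound over \<open>D\<close>.\<close>
  have "B \<subseteq> (\<Union>D\<in>conj_classes (G Mod N). {C \<in> B. \<exists>c\<in>C. N #>\<^bsub>G\<^esub> c \<in> D})"
  proof
    fix C assume C: "C \<in> B"
    then obtain c where c: "c \<in> carrier G" "c \<in> C"
      using conj_orbit_refl[OF subgroup_self] by (auto simp: B_def conj_classes_eq)
    have Q: "N #>\<^bsub>G\<^esub> c \<in> carrier (G Mod N)" using c by (auto simp: carrier_FactGroup)
    then show "C \<in> (\<Union>D\<in>conj_classes (G Mod N). {C \<in> B. \<exists>c\<in>C. N #>\<^bsub>G\<^esub> c \<in> D})"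
      using C c Q.conj_orbit_refl[OF Q.subgroup_self Q] by (auto simp: Q.conj_classes_eq)
  qed
  then have "card B \<le> card (\<Union>D\<in>conj_classes (G Mod N). {C \<in> B. \<exists>c\<in>C. N #>\<^bsub>G\<^esub> c \<in> D})"
    using finQ finB by (intro card_mono) auto
  also have "\<dots> \<le> (\<Sum>D\<in>conj_classes (G Mod N). card {C \<in> B. \<exists>c\<in>C. N #>\<^bsub>G\<^esub> c \<in> D})"
    by (rule card_UN_le[OF finQ])
  also have "\<dots> \<le> card (conj_classes (G Mod N)) * M"
  proof -
    have "card {C \<in> B. \<exists>c\<in>C. N #>\<^bsub>G\<^esub> c \<in> D} \<le> M" if D: "D \<in> conj_classes (G Mod N)" for D
    \<comment> \<open>If no class of \<open>B\<close> lies over \<open>D\<close>, the count is 0,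
      whatever \<open>M\<close> is. Otherwise \<open>g\<close> is taken from such a class, which
      puts it outside \<open>U\<close> and makes the bound \<open>M\<close> available.\<close>
    proof (cases "{C \<in> B. \<exists>c\<in>C. N #>\<^bsub>G\<^esub> c \<in> D} = {}")
      case False
      then obtain C g where g: "C \<in> B" "g \<in> C" "N #>\<^bsub>G\<^esub> g \<in> D" by blast
      have gG: "g \<in> carrier G" using g conj_class_eq by (auto simp: B_def)
      have "card {C \<in> B. \<exists>c\<in>C. N #>\<^bsub>G\<^esub> c \<in> D} \<le> card {C \<in> conj_classes G. \<exists>c\<in>C. N #>\<^bsub>G\<^esub> c \<in> D}"
        using finG by (intro card_mono) (auto simp: B_def conj_classes_eq)
      also have "\<dots> \<le> card (fixed_classes G N g)"
        using N.card_classes_over[OF finG D gG g(3)] .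
      also have "\<dots> \<le> M" using M notU g gG by blast
      finally show ?thesis .
    qed (metis card.empty le0)
    then show ?thesis using sum_bounded_above[of "conj_classes (G Mod N)" _ M] by simp
  qed
  finally have B: "card B \<le> class_number (G Mod N) * M" by (simp add: class_number_def)
  have "conj_classes G = {C \<in> conj_classes G. C \<inter> H \<noteq> {}} \<union> B" by (auto simp: B_def)
  then have "class_number G \<le> card {C \<in> conj_classes G. C \<inter> H \<noteq> {}} + card B"
    unfolding class_number_def by (metis card_Un_le)
  also have "\<dots> \<le> class_number (G\<lparr>carrier := H\<rparr>) + class_number (G Mod N) * M"
    using card_classes_meeting_subgroup[OF finG assms(3)] B by (rule add_mono)
  finally show ?thesis by (simp add: M_def U_def)
qed

end
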